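(* The logic $\mathbf{IL}^-(\mathbf{P})$ enjoys the Craig interpolation property: for any $\mathcal{L}(\rhd)$-formulas $A$ and $B$, if $\mathbf{IL}^-(\mathbf{P}) \vdash A \to B$, then there exists an $\mathcal{L}(\rhd)$-formula $C$ such that $\mathrm{var}(C) \subseteq \mathrm{var}(A) \cap \mathrm{var}(B)$, $\mathbf{IL}^-(\mathbf{P}) \vdash A \to C$, and $\mathbf{IL}^-(\mathbf{P}) \vdash C \to B$.
   Context: The language $\mathcal{L}(\rhd)$ has countably many propositional variables, the constant $\bot$, connectives $\neg, \land, \lor, \to$, a unary modal operator $\Box$ and a binary modal operator $\rhd$. $\mathrm{var}(A)$ is the set of propositional variables occurring in $A$. The logic $\mathbf{IL}^-(\mathbf{P})$ has as axioms: all tautologies in $\mathcal{L}(\rhd)$; $\Box(A \to B) \to (\Box A \to \Box B)$; $\Box(\Box A \to A) \to \Box A$; $\mathbf{J3}$: $(A \rhd C) \land (B \rhd C) \to (A \lor B) \rhd C$; $\mathbf{J6}$: $\Box A \leftrightarrow (\neg A) \rhd \bot$; and the persistence principle $\mathbf{P}$: $A \rhd B \to \Box(A \rhd B)$ (all as schemes). Its inference rules are Modus Ponens, Necessitation ($A / \Box A$), $\mathbf{R1}$: from $A \to B$ infer $C \rhd A \to C \rhd B$, and $\mathbf{R2}$: from $A \to B$ infer $B \rhd C \to A \rhd C$. *)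

theory Defs
  imports Main
begin

datatype fm =
    Var nat
  | Falsum  ("\<^bold>\<bottom>")
  | Neg fm  ("\<^bold>\<not> _" [70] 70)
  | Conj fm fm  (infixr "\<^bold>\<and>" 60)
  | Disj fm fm  (infixr "\<^bold>\<or>" 55)
  | Imp fm fm  (infixr "\<^bold>\<longrightarrow>" 50)
  | Box fm  ("\<^bold>\<box> _" [70] 70)
  | Rhd fm fm  (infix "\<rhd>" 65)

abbreviation Iff :: "fm \<Rightarrow> fm \<Rightarrow> fm"  (infix "\<^bold>\<longleftrightarrow>" 48) where
  "A \<^bold>\<longleftrightarrow> B \<equiv> (A \<^bold>\<longrightarrow> B) \<^bold>\<and> (B \<^bold>\<longrightarrow> A)"

primrec var :: "fm \<Rightarrow> nat set" where
  "var (Var p) = {p}"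
| "var \<^bold>\<bottom> = {}"
| "var (\<^bold>\<not> A) = var A"
| "var (A \<^bold>\<and> B) = var A \<union> var B"
| "var (A \<^bold>\<or> B) = var A \<union> var B"
| "var (A \<^bold>\<longrightarrow> B) = var A \<union> var B"
| "var (\<^bold>\<box> A) = var A"
| "var (A \<rhd> B) = var A \<union> var B"

text \<open>Propositional truth under a valuation \<open>v\<close>.  Formulas whose outermost symbol is modal
  are treated as additional propositional atoms; \<open>v\<close> is only consulted on variables and on
  such formulas.\<close>

primrec ptrue :: "(fm \<Rightarrow> bool) \<Rightarrow> fm \<Rightarrow> bool" where
  "ptrue v (Var p) = v (Var p)"
| "ptrue v \<^bold>\<bottom> = False"
| "ptrue v (\<^bold>\<not> A) = (\<not> ptrue v A)"
| "ptrue v (A \<^bold>\<and> B) = (ptrue v A \<and> ptrue v B)"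
| "ptrue v (A \<^bold>\<or> B) = (ptrue v A \<or> ptrue v B)"
| "ptrue v (A \<^bold>\<longrightarrow> B) = (ptrue v A \<longrightarrow> ptrue v B)"
| "ptrue v (\<^bold>\<box> A) = v (\<^bold>\<box> A)"
| "ptrue v (A \<rhd> B) = v (A \<rhd> B)"

definition tautology :: "fm \<Rightarrow> bool" where
  "tautology A \<longleftrightarrow> (\<forall>v. ptrue v A)"

inductive ILmP :: "fm \<Rightarrow> bool"  ("IL\<^sup>-'(P') \<turnstile> _" [40] 40) where
  Taut: "tautology A \<Longrightarrow> IL\<^sup>-(P) \<turnstile> A"
| K: "IL\<^sup>-(P) \<turnstile> \<^bold>\<box> (A \<^bold>\<longrightarrow> B) \<^bold>\<longrightarrow> (\<^bold>\<box> A \<^bold>\<longrightarrow> \<^bold>\<box> B)"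
| L: "IL\<^sup>-(P) \<turnstile> \<^bold>\<box> (\<^bold>\<box> A \<^bold>\<longrightarrow> A) \<^bold>\<longrightarrow> \<^bold>\<box> A"
| J3: "IL\<^sup>-(P) \<turnstile> (A \<rhd> C) \<^bold>\<and> (B \<rhd> C) \<^bold>\<longrightarrow> ((A \<^bold>\<or> B) \<rhd> C)"
| J6: "IL\<^sup>-(P) \<turnstile> \<^bold>\<box> A \<^bold>\<longleftrightarrow> ((\<^bold>\<not> A) \<rhd> \<^bold>\<bottom>)"
| P: "IL\<^sup>-(P) \<turnstile> (A \<rhd> B) \<^bold>\<longrightarrow> \<^bold>\<box> (A \<rhd> B)"
| MP: "IL\<^sup>-(P) \<turnstile> A \<^bold>\<longrightarrow> B \<Longrightarrow> IL\<^sup>-(P) \<turnstile> A \<Longrightarrow> IL\<^sup>-(P) \<turnstile> B"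
| Nec: "IL\<^sup>-(P) \<turnstile> A \<Longrightarrow> IL\<^sup>-(P) \<turnstile> \<^bold>\<box> A"
| R1: "IL\<^sup>-(P) \<turnstile> A \<^bold>\<longrightarrow> B \<Longrightarrow> IL\<^sup>-(P) \<turnstile> (C \<rhd> A) \<^bold>\<longrightarrow> (C \<rhd> B)"
| R2: "IL\<^sup>-(P) \<turnstile> A \<^bold>\<longrightarrow> B \<Longrightarrow> IL\<^sup>-(P) \<turnstile> (B \<rhd> C) \<^bold>\<longrightarrow> (A \<rhd> C)"

end

theory Submission
  imports Defs
begin

text \<open>
  The argument is semantic. Read \<open>A \<rhd> B\<close> as \<open>\<box>(A \<rightarrow> \<diamond>B)\<close>, where \<open>\<box>\<close> ranges over a
  transitive, conversely well-founded relation \<open>R\<close> and \<open>\<diamond>\<close> over an arbitrary relation \<open>S\<close>.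
  All axioms and rules are sound for this reading (\<open>soundness\<close>); the principle \<open>P\<close> is just
  transitivity of \<open>R\<close>, because \<open>S\<close> does not depend on the world at which \<open>\<rhd>\<close> is evaluated.

  Call \<open>\<alpha>\<close> and \<open>\<beta>\<close> separable if some formula in the common variables follows from \<open>\<alpha>\<close> and
  refutes \<open>\<beta>\<close>. If \<open>A \<rightarrow> B\<close> had no interpolant, \<open>A\<close> and \<open>\<not>B\<close> would be inseparable, and the
  claim is that inseparable formulas are jointly satisfiable; this contradicts soundness when
  \<open>A \<rightarrow> B\<close> is provable. The model consists of triples \<open>(\<alpha>, \<beta>, D)\<close> where \<open>\<alpha>\<close> decides the
  subformulas of \<open>A\<close>, \<open>\<beta>\<close> those of \<open>B\<close>, the two are inseparable, and \<open>D\<close> is a tag: the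
  \<open>S\<close>-successors of the triple are the triples at which \<open>D\<close> fails. Along \<open>R\<close> the true
  \<open>\<rhd>\<close>-formulas grow strictly, which makes \<open>R\<close> conversely well-founded.

  The heart is \<open>inseparable_successor\<close>. To refute \<open>C \<rhd> D\<close> one needs an inseparable
  successor with tag \<open>D\<close> that satisfies \<open>C\<close> and \<open>C \<rhd> D\<close>, keeps all \<open>\<rhd>\<close>-formulas \<open>X \<rhd> Y\<close>, and
  refutes \<open>X\<close> whenever no triple satisfies \<open>Y\<close> and refutes \<open>D\<close>. Say \<open>C \<rhd> D\<close> belongs to the
  side of \<open>\<alpha>\<close>. If the required formulas were separated by \<open>E\<close>, and \<open>N\<close> is the
  disjunction of the interpolants between \<open>D\<close> and those \<open>Y\<close> of the other side that imply it,
  then \<open>E \<rhd> N\<close> would follow from \<open>\<beta>\<close> and be refuted by \<open>\<alpha>\<close>, so the original pair would be separable.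

  The model is built for formulas over variables, \<open>\<bottom>\<close>, \<open>\<rightarrow>\<close> and \<open>\<rhd>\<close> only. The translation \<open>tr\<close>
  into this fragment, with \<open>(\<not>A) \<rhd> \<bottom>\<close> for \<open>\<box>A\<close>, preserves variables and provable equivalence.
\<close>

section \<open>Reasoning inside the logic\<close>

lemma taut_infer:
  assumes "\<And>v. ptrue v A"
  shows "IL\<^sup>-(P) \<turnstile> A"
  using assms by (simp add: ILmP.Taut tautology_def)

lemma taut_infer1:
  assumes "IL\<^sup>-(P) \<turnstile> A" "\<And>v. ptrue v A \<Longrightarrow> ptrue v B"
  shows "IL\<^sup>-(P) \<turnstile> B"
proof -
  have "IL\<^sup>-(P) \<turnstile> A \<^bold>\<longrightarrow> B" using assms(2) by (intro taut_infer) simp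
  then show ?thesis using assms(1) by (rule ILmP.MP)
qed

lemma taut_infer2:
  assumes "IL\<^sup>-(P) \<turnstile> A" "IL\<^sup>-(P) \<turnstile> B" "\<And>v. ptrue v A \<Longrightarrow> ptrue v B \<Longrightarrow> ptrue v C"
  shows "IL\<^sup>-(P) \<turnstile> C"
proof -
  have "IL\<^sup>-(P) \<turnstile> B \<^bold>\<longrightarrow> C" using assms(1) by (rule taut_infer1) (simp add: assms(3))
  then show ?thesis using assms(2) by (rule ILmP.MP)
qed

lemma taut_infer3:
  assumes "IL\<^sup>-(P) \<turnstile> A" "IL\<^sup>-(P) \<turnstile> B" "IL\<^sup>-(P) \<turnstile> C"
    and "\<And>v. ptrue v A \<Longrightarrow> ptrue v B \<Longrightarrow> ptrue v C \<Longrightarrow> ptrue v D"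
  shows "IL\<^sup>-(P) \<turnstile> D"
proof -
  have "IL\<^sup>-(P) \<turnstile> C \<^bold>\<longrightarrow> D" using assms(1,2) by (rule taut_infer2) (simp add: assms(4))
  then show ?thesis using assms(3) by (rule ILmP.MP)
qed

lemma imp_trans:
  "IL\<^sup>-(P) \<turnstile> A \<^bold>\<longrightarrow> B \<Longrightarrow> IL\<^sup>-(P) \<turnstile> B \<^bold>\<longrightarrow> C \<Longrightarrow> IL\<^sup>-(P) \<turnstile> A \<^bold>\<longrightarrow> C"
  by (erule taut_infer2) auto

fun conjl :: "fm list \<Rightarrow> fm" where
  "conjl [] = \<^bold>\<not> \<^bold>\<bottom>"
| "conjl (A # As) = A \<^bold>\<and> conjl As"

fun disjl :: "fm list \<Rightarrow> fm" where
  "disjl [] = \<^bold>\<bottom>"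
| "disjl (A # As) = A \<^bold>\<or> disjl As"

lemma ptrue_conjl [simp]: "ptrue v (conjl As) \<longleftrightarrow> (\<forall>A\<in>set As. ptrue v A)"
  by (induction As) auto

lemma ptrue_disjl [simp]: "ptrue v (disjl As) \<longleftrightarrow> (\<exists>A\<in>set As. ptrue v A)"
  by (induction As) auto

lemma var_disjl: "var (disjl As) = (\<Union>A\<in>set As. var A)"
  by (induction As) auto

lemma conjl_imp: "A \<in> set As \<Longrightarrow> IL\<^sup>-(P) \<turnstile> conjl As \<^bold>\<longrightarrow> A"
  by (rule taut_infer) simp

lemma imp_conjl:
  "(\<And>A. A \<in> set As \<Longrightarrow> IL\<^sup>-(P) \<turnstile> H \<^bold>\<longrightarrow> A) \<Longrightarrow> IL\<^sup>-(P) \<turnstile> H \<^bold>\<longrightarrow> conjl As"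
proof (induction As)
  case Nil
  show ?case by (rule taut_infer) simp
next
  case (Cons A As)
  then have "IL\<^sup>-(P) \<turnstile> H \<^bold>\<longrightarrow> A" "IL\<^sup>-(P) \<turnstile> H \<^bold>\<longrightarrow> conjl As" by simp_all
  then show ?case by (rule taut_infer2) auto
qed

lemma disjl_imp:
  "(\<And>A. A \<in> set As \<Longrightarrow> IL\<^sup>-(P) \<turnstile> A \<^bold>\<longrightarrow> H) \<Longrightarrow> IL\<^sup>-(P) \<turnstile> disjl As \<^bold>\<longrightarrow> H"
proof (induction As)
  case Nil
  show ?case by (rule taut_infer) simp
next
  case (Cons A As)
  then have "IL\<^sup>-(P) \<turnstile> A \<^bold>\<longrightarrow> H" "IL\<^sup>-(P) \<turnstile> disjl As \<^bold>\<longrightarrow> H" by simp_all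
  then show ?case by (rule taut_infer2) auto
qed

lemma box_mono:
  assumes "IL\<^sup>-(P) \<turnstile> A \<^bold>\<longrightarrow> B"
  shows "IL\<^sup>-(P) \<turnstile> \<^bold>\<box> A \<^bold>\<longrightarrow> \<^bold>\<box> B"
  using ILmP.K ILmP.Nec[OF assms] by (rule ILmP.MP)

lemma box_conj: "IL\<^sup>-(P) \<turnstile> \<^bold>\<box> A \<^bold>\<and> \<^bold>\<box> B \<^bold>\<longrightarrow> \<^bold>\<box> (A \<^bold>\<and> B)"
proof -
  have "IL\<^sup>-(P) \<turnstile> A \<^bold>\<longrightarrow> (B \<^bold>\<longrightarrow> A \<^bold>\<and> B)" by (rule taut_infer) simp
  from box_mono[OF this] ILmP.K[of B "A \<^bold>\<and> B"] show ?thesis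
    by (rule taut_infer2) auto
qed

text \<open>The replacement for the absent \<open>\<box>(A \<rightarrow> B) \<rightarrow> A \<rhd> B\<close>: necessity may be used on the
  left of \<open>\<rhd>\<close>, since the exceptional part \<open>A \<and> \<not>B\<close> interprets \<open>\<bottom>\<close>, hence anything.\<close>

lemma box_rhd_left: "IL\<^sup>-(P) \<turnstile> \<^bold>\<box> (A \<^bold>\<longrightarrow> B) \<^bold>\<longrightarrow> ((B \<rhd> C) \<^bold>\<longrightarrow> (A \<rhd> C))"
proof -
  let ?X = "\<^bold>\<not> (A \<^bold>\<longrightarrow> B)"
  have "IL\<^sup>-(P) \<turnstile> \<^bold>\<bottom> \<^bold>\<longrightarrow> C" by (rule taut_infer) simp
  from ILmP.R1[OF this] ILmP.J6 have 1: "IL\<^sup>-(P) \<turnstile> \<^bold>\<box> (A \<^bold>\<longrightarrow> B) \<^bold>\<longrightarrow> (?X \<rhd> C)"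
    by (rule taut_infer2[where A="(?X \<rhd> \<^bold>\<bottom>) \<^bold>\<longrightarrow> (?X \<rhd> C)"]) auto
  have "IL\<^sup>-(P) \<turnstile> A \<^bold>\<longrightarrow> ?X \<^bold>\<or> B" by (rule taut_infer) simp
  from 1 ILmP.J3[of ?X C B] ILmP.R2[OF this] show ?thesis
    by (rule taut_infer3) auto
qed

lemma disjl_rhd:
  "(\<And>X. X \<in> set Xs \<Longrightarrow> IL\<^sup>-(P) \<turnstile> H \<^bold>\<longrightarrow> (X \<rhd> D)) \<Longrightarrow> IL\<^sup>-(P) \<turnstile> H \<^bold>\<longrightarrow> (disjl Xs \<rhd> D)"
proof (induction Xs)
  case Nil
  have "IL\<^sup>-(P) \<turnstile> \<^bold>\<not> \<^bold>\<bottom>" by (rule taut_infer) simp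
  from ILmP.Nec[OF this] ILmP.J6 have 1: "IL\<^sup>-(P) \<turnstile> (\<^bold>\<not> \<^bold>\<not> \<^bold>\<bottom>) \<rhd> \<^bold>\<bottom>"
    by (rule taut_infer2) auto
  have "IL\<^sup>-(P) \<turnstile> \<^bold>\<bottom> \<^bold>\<longrightarrow> D" "IL\<^sup>-(P) \<turnstile> \<^bold>\<bottom> \<^bold>\<longrightarrow> \<^bold>\<not> \<^bold>\<not> \<^bold>\<bottom>"
    by (rule taut_infer, simp)+
  from 1 ILmP.R1[OF this(1)] ILmP.R2[OF this(2)] have "IL\<^sup>-(P) \<turnstile> \<^bold>\<bottom> \<rhd> D"
    by (meson ILmP.MP)
  then show ?case by (rule taut_infer1) simp
next
  case (Cons X Xs)
  then have "IL\<^sup>-(P) \<turnstile> H \<^bold>\<longrightarrow> (X \<rhd> D)" "IL\<^sup>-(P) \<turnstile> H \<^bold>\<longrightarrow> (disjl Xs \<rhd> D)" by simp_all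
  from this ILmP.J3[of X D "disjl Xs"] show ?case unfolding disjl.simps by (rule taut_infer3) auto
qed

text \<open>The form that Loeb's principle takes for \<open>\<rhd>\<close>: a last world with \<open>C\<close> and
  without \<open>\<diamond>D\<close> also satisfies \<open>C \<rhd> D\<close>. Syntactically, \<open>(C \<and> F) \<rhd> D\<close> and \<open>\<box>F\<close> give
  \<open>F = C \<rhd> D\<close>, and the premise is itself persistent, so Loeb's axiom yields \<open>\<box>F\<close>.\<close>

lemma rhd_loeb: "IL\<^sup>-(P) \<turnstile> ((C \<^bold>\<and> (C \<rhd> D)) \<rhd> D) \<^bold>\<longrightarrow> (C \<rhd> D)"
proof -
  let ?F = "C \<rhd> D" and ?H = "(C \<^bold>\<and> (C \<rhd> D)) \<rhd> D"
  have "IL\<^sup>-(P) \<turnstile> ?F \<^bold>\<longrightarrow> (C \<^bold>\<longrightarrow> C \<^bold>\<and> ?F)" by (rule taut_infer) simp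
  from box_mono[OF this] box_rhd_left have 1: "IL\<^sup>-(P) \<turnstile> ?H \<^bold>\<longrightarrow> (\<^bold>\<box> ?F \<^bold>\<longrightarrow> ?F)"
    by (rule taut_infer2) auto
  from ILmP.P box_mono[OF 1] ILmP.L have "IL\<^sup>-(P) \<turnstile> ?H \<^bold>\<longrightarrow> \<^bold>\<box> ?F"
    by (rule taut_infer3) auto
  with 1 show ?thesis by (rule taut_infer2) auto
qed

lemma persistent_conjl:
  "(\<And>A. A \<in> set As \<Longrightarrow> IL\<^sup>-(P) \<turnstile> A \<^bold>\<longrightarrow> \<^bold>\<box> A) \<Longrightarrow> IL\<^sup>-(P) \<turnstile> conjl As \<^bold>\<longrightarrow> \<^bold>\<box> (conjl As)"
proof (induction As)
  case Nil
  have "IL\<^sup>-(P) \<turnstile> conjl []" by (rule taut_infer) simp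
  from ILmP.Nec[OF this] show ?case by (rule taut_infer1) simp
next
  case (Cons A As)
  then have "IL\<^sup>-(P) \<turnstile> A \<^bold>\<longrightarrow> \<^bold>\<box> A" "IL\<^sup>-(P) \<turnstile> conjl As \<^bold>\<longrightarrow> \<^bold>\<box> (conjl As)" by simp_all
  from this box_conj[of A "conjl As"] show ?case unfolding conjl.simps by (rule taut_infer3) auto
qed

text \<open>This is the derivable sequent rule that introduces \<open>\<rhd>\<close> on the right. The diagonal
  formula \<open>C \<rhd> D\<close> in the premise comes from \<open>rhd_loeb\<close>.\<close>

lemma rhd_intro:
  assumes pers: "IL\<^sup>-(P) \<turnstile> H \<^bold>\<longrightarrow> \<^bold>\<box> H"
    and prem: "IL\<^sup>-(P) \<turnstile> H \<^bold>\<longrightarrow> (C \<^bold>\<and> (C \<rhd> D) \<^bold>\<longrightarrow> disjl Xs)"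
    and rhds: "\<And>X. X \<in> set Xs \<Longrightarrow> IL\<^sup>-(P) \<turnstile> H \<^bold>\<longrightarrow> (X \<rhd> D)"
  shows "IL\<^sup>-(P) \<turnstile> H \<^bold>\<longrightarrow> (C \<rhd> D)"
proof -
  from imp_trans[OF pers box_mono[OF prem]] box_rhd_left disjl_rhd[OF rhds]
  have "IL\<^sup>-(P) \<turnstile> H \<^bold>\<longrightarrow> ((C \<^bold>\<and> (C \<rhd> D)) \<rhd> D)"
    by (rule taut_infer3) auto
  then show ?thesis using rhd_loeb by (rule imp_trans)
qed

section \<open>Separation\<close>

definition sep :: "nat set \<Rightarrow> fm \<Rightarrow> fm \<Rightarrow> bool" where
  "sep V \<alpha> \<beta> \<longleftrightarrow> (\<exists>E. var E \<subseteq> V \<and> (IL\<^sup>-(P) \<turnstile> \<alpha> \<^bold>\<longrightarrow> E) \<and> (IL\<^sup>-(P) \<turnstile> E \<^bold>\<longrightarrow> \<^bold>\<not> \<beta>))"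

lemma sepI: "var E \<subseteq> V \<Longrightarrow> IL\<^sup>-(P) \<turnstile> \<alpha> \<^bold>\<longrightarrow> E \<Longrightarrow> IL\<^sup>-(P) \<turnstile> E \<^bold>\<longrightarrow> \<^bold>\<not> \<beta> \<Longrightarrow> sep V \<alpha> \<beta>"
  unfolding sep_def by blast

lemma sep_sym:
  assumes "sep V \<alpha> \<beta>"
  shows "sep V \<beta> \<alpha>"
proof -
  from assms obtain E where "var E \<subseteq> V" and
    1: "IL\<^sup>-(P) \<turnstile> \<alpha> \<^bold>\<longrightarrow> E" and 2: "IL\<^sup>-(P) \<turnstile> E \<^bold>\<longrightarrow> \<^bold>\<not> \<beta>" unfolding sep_def by blast
  moreover from 2 have "IL\<^sup>-(P) \<turnstile> \<beta> \<^bold>\<longrightarrow> \<^bold>\<not> E" by (rule taut_infer1) auto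
  moreover from 1 have "IL\<^sup>-(P) \<turnstile> \<^bold>\<not> E \<^bold>\<longrightarrow> \<^bold>\<not> \<alpha>" by (rule taut_infer1) auto
  ultimately show ?thesis by (intro sepI[of "\<^bold>\<not> E"]) auto
qed

text \<open>Disjunctions of separating formulas separate, so one of \<open>F\<close>, \<open>\<not>F\<close> can always be added to
  an inseparable pair: this is what makes Lindenbaum extensions possible.\<close>

lemma sep_cases:
  assumes "sep V (\<alpha> \<^bold>\<and> F) \<beta>" "sep V (\<alpha> \<^bold>\<and> \<^bold>\<not> F) \<beta>"
  shows "sep V \<alpha> \<beta>"
proof -
  from assms obtain E1 E2 where v: "var E1 \<subseteq> V" "var E2 \<subseteq> V"
    and 1: "IL\<^sup>-(P) \<turnstile> \<alpha> \<^bold>\<and> F \<^bold>\<longrightarrow> E1" "IL\<^sup>-(P) \<turnstile> E1 \<^bold>\<longrightarrow> \<^bold>\<not> \<beta>"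
    and 2: "IL\<^sup>-(P) \<turnstile> \<alpha> \<^bold>\<and> \<^bold>\<not> F \<^bold>\<longrightarrow> E2" "IL\<^sup>-(P) \<turnstile> E2 \<^bold>\<longrightarrow> \<^bold>\<not> \<beta>"
    unfolding sep_def by blast
  from 1(1) 2(1) have "IL\<^sup>-(P) \<turnstile> \<alpha> \<^bold>\<longrightarrow> E1 \<^bold>\<or> E2" by (rule taut_infer2) auto
  moreover from 1(2) 2(2) have "IL\<^sup>-(P) \<turnstile> E1 \<^bold>\<or> E2 \<^bold>\<longrightarrow> \<^bold>\<not> \<beta>" by (rule taut_infer2) auto
  ultimately show ?thesis using v by (intro sepI[of "E1 \<^bold>\<or> E2"]) auto
qed

definition decides :: "fm \<Rightarrow> fm set \<Rightarrow> bool" where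
  "decides \<alpha> \<Phi> \<longleftrightarrow> (\<forall>F\<in>\<Phi>. (IL\<^sup>-(P) \<turnstile> \<alpha> \<^bold>\<longrightarrow> F) \<or> (IL\<^sup>-(P) \<turnstile> \<alpha> \<^bold>\<longrightarrow> \<^bold>\<not> F))"

lemma decides_extension:
  assumes "finite \<Phi>" "\<not> sep V \<alpha> \<beta>"
  shows "\<exists>\<alpha>'. (IL\<^sup>-(P) \<turnstile> \<alpha>' \<^bold>\<longrightarrow> \<alpha>) \<and> \<not> sep V \<alpha>' \<beta> \<and> decides \<alpha>' \<Phi>"
  using assms
proof (induction \<Phi>)
  case empty
  have "IL\<^sup>-(P) \<turnstile> \<alpha> \<^bold>\<longrightarrow> \<alpha>" by (rule taut_infer) simp
  with empty show ?case unfolding decides_def by blast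
next
  case (insert F \<Phi>)
  then obtain \<alpha>' where a: "IL\<^sup>-(P) \<turnstile> \<alpha>' \<^bold>\<longrightarrow> \<alpha>" "\<not> sep V \<alpha>' \<beta>" "decides \<alpha>' \<Phi>" by blast
  then obtain G where G: "G = F \<or> G = \<^bold>\<not> F" and ns: "\<not> sep V (\<alpha>' \<^bold>\<and> G) \<beta>"
    using sep_cases by blast
  have l: "IL\<^sup>-(P) \<turnstile> \<alpha>' \<^bold>\<and> G \<^bold>\<longrightarrow> \<alpha>'" and r: "IL\<^sup>-(P) \<turnstile> \<alpha>' \<^bold>\<and> G \<^bold>\<longrightarrow> G"
    by (rule taut_infer, simp)+
  have "decides (\<alpha>' \<^bold>\<and> G) (insert F \<Phi>)"
    using a(3) G r imp_trans[OF l] unfolding decides_def by blast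
  with ns imp_trans[OF l a(1)] show ?case by blast
qed

lemma decides_extension_pair:
  assumes "finite \<Phi>1" "finite \<Phi>2" "\<not> sep V \<alpha> \<beta>"
  obtains \<alpha>' \<beta>' where "IL\<^sup>-(P) \<turnstile> \<alpha>' \<^bold>\<longrightarrow> \<alpha>" "IL\<^sup>-(P) \<turnstile> \<beta>' \<^bold>\<longrightarrow> \<beta>" "\<not> sep V \<alpha>' \<beta>'"
    "decides \<alpha>' \<Phi>1" "decides \<beta>' \<Phi>2"
  by (metis assms decides_extension sep_sym)

text \<open>The interpolation step for \<open>\<rhd>\<close>. The sets \<open>\<Gamma>1\<close>, \<open>\<Gamma>2\<close> collect the pairs \<open>(X, Y)\<close> with
  \<open>X \<rhd> Y\<close> true on either side; \<open>I1\<close>, \<open>I2\<close> are the pairs for which no \<open>S\<close>-successor satisfying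
  \<open>Y\<close> can avoid \<open>D\<close>, so that \<open>X\<close> must fail in the successor. On the first side
  separability of \<open>Y \<and> \<not>D\<close> from truth just means \<open>Y \<turnstile> D\<close>, because \<open>D\<close> belongs to that side;
  on the second side it provides an interpolant between \<open>Y\<close> and \<open>D\<close>.\<close>

lemma inseparable_successor:
  assumes insep: "\<not> sep V \<alpha> \<beta>" and fin: "finite \<Gamma>1" "finite \<Gamma>2"
    and \<Gamma>1: "\<And>X Y. (X, Y) \<in> \<Gamma>1 \<Longrightarrow> IL\<^sup>-(P) \<turnstile> \<alpha> \<^bold>\<longrightarrow> (X \<rhd> Y)"
    and \<Gamma>2: "\<And>X Y. (X, Y) \<in> \<Gamma>2 \<Longrightarrow> IL\<^sup>-(P) \<turnstile> \<beta> \<^bold>\<longrightarrow> (X \<rhd> Y)"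
    and neg: "IL\<^sup>-(P) \<turnstile> \<alpha> \<^bold>\<longrightarrow> \<^bold>\<not> (C \<rhd> D)"
    and sub: "I1 \<subseteq> \<Gamma>1" "I2 \<subseteq> \<Gamma>2"
    and I1: "\<And>X Y. (X, Y) \<in> I1 \<Longrightarrow> sep V (Y \<^bold>\<and> \<^bold>\<not> D) (\<^bold>\<not> \<^bold>\<bottom>)"
    and I2: "\<And>X Y. (X, Y) \<in> I2 \<Longrightarrow> sep V (\<^bold>\<not> D) Y"
  obtains \<alpha>' \<beta>' where "\<not> sep V \<alpha>' \<beta>'"
    "IL\<^sup>-(P) \<turnstile> \<alpha>' \<^bold>\<longrightarrow> C" "IL\<^sup>-(P) \<turnstile> \<alpha>' \<^bold>\<longrightarrow> (C \<rhd> D)"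
    "\<And>X Y. (X, Y) \<in> \<Gamma>1 \<Longrightarrow> IL\<^sup>-(P) \<turnstile> \<alpha>' \<^bold>\<longrightarrow> (X \<rhd> Y)"
    "\<And>X Y. (X, Y) \<in> \<Gamma>2 \<Longrightarrow> IL\<^sup>-(P) \<turnstile> \<beta>' \<^bold>\<longrightarrow> (X \<rhd> Y)"
    "\<And>X Y. (X, Y) \<in> I1 \<Longrightarrow> IL\<^sup>-(P) \<turnstile> \<alpha>' \<^bold>\<longrightarrow> \<^bold>\<not> X"
    "\<And>X Y. (X, Y) \<in> I2 \<Longrightarrow> IL\<^sup>-(P) \<turnstile> \<beta>' \<^bold>\<longrightarrow> \<^bold>\<not> X"
proof -
  obtain g1 where g1: "set g1 = \<Gamma>1" using fin(1) finite_list by blast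
  obtain g2 where g2: "set g2 = \<Gamma>2" using fin(2) finite_list by blast
  obtain i1 where i1: "set i1 = I1" using fin(1) sub(1) finite_list finite_subset by metis
  obtain i2 where i2: "set i2 = I2" using fin(2) sub(2) finite_list finite_subset by metis
  define G1 where "G1 = map (\<lambda>(X, Y). X \<rhd> Y) g1"
  define G2 where "G2 = map (\<lambda>(X, Y). X \<rhd> Y) g2"
  have G1: "F \<in> set G1 \<longleftrightarrow> (\<exists>X Y. F = X \<rhd> Y \<and> (X, Y) \<in> \<Gamma>1)" for F
    unfolding G1_def using g1 by force
  have G2: "F \<in> set G2 \<longleftrightarrow> (\<exists>X Y. F = X \<rhd> Y \<and> (X, Y) \<in> \<Gamma>2)" for F
    unfolding G2_def using g2 by force
  define \<alpha>' where "\<alpha>' = conjl G1 \<^bold>\<and> (C \<^bold>\<and> ((C \<rhd> D) \<^bold>\<and> \<^bold>\<not> disjl (map fst i1)))"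
  define \<beta>' where "\<beta>' = conjl G2 \<^bold>\<and> \<^bold>\<not> disjl (map fst i2)"
  have YD: "IL\<^sup>-(P) \<turnstile> Y \<^bold>\<longrightarrow> D" if "(X, Y) \<in> I1" for X Y
  proof -
    from I1[OF that] obtain E where
      "IL\<^sup>-(P) \<turnstile> Y \<^bold>\<and> \<^bold>\<not> D \<^bold>\<longrightarrow> E" "IL\<^sup>-(P) \<turnstile> E \<^bold>\<longrightarrow> \<^bold>\<not> \<^bold>\<not> \<^bold>\<bottom>" unfolding sep_def by blast
    then show ?thesis by (rule taut_infer2) auto
  qed
  have "\<exists>M. var M \<subseteq> V \<and> (IL\<^sup>-(P) \<turnstile> Y \<^bold>\<longrightarrow> M) \<and> (IL\<^sup>-(P) \<turnstile> M \<^bold>\<longrightarrow> D)" if "(X, Y) \<in> I2" for X Y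
  proof -
    from sep_sym[OF I2[OF that]] obtain E where
      E: "var E \<subseteq> V" "IL\<^sup>-(P) \<turnstile> Y \<^bold>\<longrightarrow> E" "IL\<^sup>-(P) \<turnstile> E \<^bold>\<longrightarrow> \<^bold>\<not> \<^bold>\<not> D" unfolding sep_def by blast
    from E(3) have "IL\<^sup>-(P) \<turnstile> E \<^bold>\<longrightarrow> D" by (rule taut_infer1) auto
    with E show ?thesis by blast
  qed
  then obtain m where m: "\<And>X Y. (X, Y) \<in> I2 \<Longrightarrow>
      var (m Y) \<subseteq> V \<and> (IL\<^sup>-(P) \<turnstile> Y \<^bold>\<longrightarrow> m Y) \<and> (IL\<^sup>-(P) \<turnstile> m Y \<^bold>\<longrightarrow> D)"
    using bchoice[of "snd ` I2"
        "\<lambda>Y M. var M \<subseteq> V \<and> (IL\<^sup>-(P) \<turnstile> Y \<^bold>\<longrightarrow> M) \<and> (IL\<^sup>-(P) \<turnstile> M \<^bold>\<longrightarrow> D)"]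
    by force
  (* N is a single formula in the common variables between D and every Y from I2. *)
  define N where "N = disjl (map (m \<circ> snd) i2)"
  have varN: "var N \<subseteq> V" unfolding N_def var_disjl using m i2 by fastforce
  have ND: "IL\<^sup>-(P) \<turnstile> N \<^bold>\<longrightarrow> D"
    unfolding N_def by (rule disjl_imp) (use m i2 in force)
  have YN: "IL\<^sup>-(P) \<turnstile> Y \<^bold>\<longrightarrow> N" if "(X, Y) \<in> I2" for X Y
  proof -
    have "IL\<^sup>-(P) \<turnstile> m Y \<^bold>\<longrightarrow> N" unfolding N_def
      by (rule taut_infer) (use that i2 in force)
    with m[OF that] show ?thesis using imp_trans by blast
  qed
  have "\<not> sep V \<alpha>' \<beta>'"
  proof
    assume "sep V \<alpha>' \<beta>'"
    then obtain E where varE: "var E \<subseteq> V" and E1: "IL\<^sup>-(P) \<turnstile> \<alpha>' \<^bold>\<longrightarrow> E"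
      and E2: "IL\<^sup>-(P) \<turnstile> E \<^bold>\<longrightarrow> \<^bold>\<not> \<beta>'" unfolding sep_def by blast
    (* The formula E |> N separates the original pair: the second side proves it, while on the
       first side it would yield C |> D. *)
    have b: "IL\<^sup>-(P) \<turnstile> \<beta> \<^bold>\<longrightarrow> (E \<rhd> N)"
    proof -
      have "IL\<^sup>-(P) \<turnstile> conjl G2 \<^bold>\<longrightarrow> (E \<rhd> N)"
      proof (rule rhd_intro)
        show "IL\<^sup>-(P) \<turnstile> conjl G2 \<^bold>\<longrightarrow> \<^bold>\<box> conjl G2"
          by (rule persistent_conjl) (auto simp: G2 intro: ILmP.P)
        from E2 show "IL\<^sup>-(P) \<turnstile> conjl G2 \<^bold>\<longrightarrow> (E \<^bold>\<and> (E \<rhd> N) \<^bold>\<longrightarrow> disjl (map fst i2))"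
          unfolding \<beta>'_def by (rule taut_infer1) auto
        fix X assume "X \<in> set (map fst i2)"
        then obtain Y where XY: "(X, Y) \<in> I2" using i2 by auto
        then have "IL\<^sup>-(P) \<turnstile> conjl G2 \<^bold>\<longrightarrow> (X \<rhd> Y)"
          using sub(2) G2 by (intro conjl_imp) blast
        then show "IL\<^sup>-(P) \<turnstile> conjl G2 \<^bold>\<longrightarrow> (X \<rhd> N)"
          using ILmP.R1[OF YN[OF XY]] by (rule imp_trans)
      qed
      moreover have "IL\<^sup>-(P) \<turnstile> \<beta> \<^bold>\<longrightarrow> conjl G2" by (rule imp_conjl) (auto simp: G2 \<Gamma>2)
      ultimately show ?thesis using imp_trans by blast
    qed
    have a: "IL\<^sup>-(P) \<turnstile> \<alpha> \<^bold>\<longrightarrow> \<^bold>\<not> (E \<rhd> N)"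
    proof -
      let ?H = "conjl ((E \<rhd> N) # G1)"
      have "IL\<^sup>-(P) \<turnstile> ?H \<^bold>\<longrightarrow> (C \<rhd> D)"
      proof (rule rhd_intro)
        show "IL\<^sup>-(P) \<turnstile> ?H \<^bold>\<longrightarrow> \<^bold>\<box> ?H"
          by (rule persistent_conjl) (auto simp: G1 intro: ILmP.P)
        from E1 show "IL\<^sup>-(P) \<turnstile> ?H \<^bold>\<longrightarrow> (C \<^bold>\<and> (C \<rhd> D) \<^bold>\<longrightarrow> disjl (E # map fst i1))"
          unfolding \<alpha>'_def by (rule taut_infer1) auto
        fix X assume X: "X \<in> set (E # map fst i1)"
        have "\<exists>Y. (IL\<^sup>-(P) \<turnstile> ?H \<^bold>\<longrightarrow> (X \<rhd> Y)) \<and> (IL\<^sup>-(P) \<turnstile> Y \<^bold>\<longrightarrow> D)"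
        proof (cases "X = E")
          case True
          then have "IL\<^sup>-(P) \<turnstile> ?H \<^bold>\<longrightarrow> (X \<rhd> N)" by (intro conjl_imp) auto
          with ND show ?thesis by blast
        next
          case False
          with X obtain Y where XY: "(X, Y) \<in> I1" using i1 by auto
          then have "IL\<^sup>-(P) \<turnstile> ?H \<^bold>\<longrightarrow> (X \<rhd> Y)"
            using sub(1) G1 by (intro conjl_imp) auto
          with YD[OF XY] show ?thesis by blast
        qed
        then show "IL\<^sup>-(P) \<turnstile> ?H \<^bold>\<longrightarrow> (X \<rhd> D)" using ILmP.R1 imp_trans by blast
      qed
      moreover have "IL\<^sup>-(P) \<turnstile> \<alpha> \<^bold>\<longrightarrow> conjl G1" by (rule imp_conjl) (auto simp: G1 \<Gamma>1)
      ultimately show ?thesis using neg by (rule taut_infer3) auto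
    qed
    from b have "IL\<^sup>-(P) \<turnstile> \<^bold>\<not> (E \<rhd> N) \<^bold>\<longrightarrow> \<^bold>\<not> \<beta>" by (rule taut_infer1) auto
    with a have "sep V \<alpha> \<beta>" using varE varN by (intro sepI[of "\<^bold>\<not> (E \<rhd> N)"]) auto
    with insep show False by blast
  qed
  moreover have "IL\<^sup>-(P) \<turnstile> \<alpha>' \<^bold>\<longrightarrow> C" "IL\<^sup>-(P) \<turnstile> \<alpha>' \<^bold>\<longrightarrow> (C \<rhd> D)"
    unfolding \<alpha>'_def by (rule taut_infer, simp)+
  moreover have "IL\<^sup>-(P) \<turnstile> \<alpha>' \<^bold>\<longrightarrow> (X \<rhd> Y)" if "(X, Y) \<in> \<Gamma>1" for X Y
  proof -
    have "IL\<^sup>-(P) \<turnstile> conjl G1 \<^bold>\<longrightarrow> (X \<rhd> Y)" using that G1 by (intro conjl_imp) blast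
    then show ?thesis unfolding \<alpha>'_def by (rule taut_infer1) auto
  qed
  moreover have "IL\<^sup>-(P) \<turnstile> \<beta>' \<^bold>\<longrightarrow> (X \<rhd> Y)" if "(X, Y) \<in> \<Gamma>2" for X Y
  proof -
    have "IL\<^sup>-(P) \<turnstile> conjl G2 \<^bold>\<longrightarrow> (X \<rhd> Y)" using that G2 by (intro conjl_imp) blast
    then show ?thesis unfolding \<beta>'_def by (rule taut_infer1) auto
  qed
  moreover have "IL\<^sup>-(P) \<turnstile> \<alpha>' \<^bold>\<longrightarrow> \<^bold>\<not> X" if "(X, Y) \<in> I1" for X Y
    unfolding \<alpha>'_def using that i1 by (intro taut_infer) force
  moreover have "IL\<^sup>-(P) \<turnstile> \<beta>' \<^bold>\<longrightarrow> \<^bold>\<not> X" if "(X, Y) \<in> I2" for X Y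
    unfolding \<beta>'_def using that i2 by (intro taut_infer) force
  ultimately show ?thesis using that by blast
qed

section \<open>Relational semantics\<close>

primrec sat :: "('w \<Rightarrow> 'w \<Rightarrow> bool) \<Rightarrow> ('w \<Rightarrow> 'w \<Rightarrow> bool) \<Rightarrow> ('w \<Rightarrow> nat \<Rightarrow> bool) \<Rightarrow> 'w \<Rightarrow> fm \<Rightarrow> bool"
where
  "sat R S v x (Var p) = v x p"
| "sat R S v x \<^bold>\<bottom> = False"
| "sat R S v x (\<^bold>\<not> A) = (\<not> sat R S v x A)"
| "sat R S v x (A \<^bold>\<and> B) = (sat R S v x A \<and> sat R S v x B)"
| "sat R S v x (A \<^bold>\<or> B) = (sat R S v x A \<or> sat R S v x B)"
| "sat R S v x (A \<^bold>\<longrightarrow> B) = (sat R S v x A \<longrightarrow> sat R S v x B)"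
| "sat R S v x (\<^bold>\<box> A) = (\<forall>y. R x y \<longrightarrow> sat R S v y A)"
| "sat R S v x (A \<rhd> B) = (\<forall>y. R x y \<longrightarrow> sat R S v y A \<longrightarrow> (\<exists>z. S y z \<and> sat R S v z B))"

lemma ptrue_sat: "ptrue (sat R S v x) A = sat R S v x A"
  by (induction A) auto

lemma soundness:
  assumes "IL\<^sup>-(P) \<turnstile> A" and trans: "transp R" and wf: "wfP R\<inverse>\<inverse>"
  shows "sat R S v x A"
  using assms(1)
proof (induction arbitrary: x rule: ILmP.induct)
  case (Taut A)
  then show ?case by (metis ptrue_sat tautology_def)
next
  case (L A)
  have "(\<forall>z. R y z \<longrightarrow> sat R S v z (\<^bold>\<box> A \<^bold>\<longrightarrow> A)) \<longrightarrow> (\<forall>z. R y z \<longrightarrow> sat R S v z A)" for y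
    using wf
  proof (induction y rule: wfp_induct_rule)
    case (less y)
    show ?case
    proof (intro impI allI)
      fix z assume hyp: "\<forall>u. R y u \<longrightarrow> sat R S v u (\<^bold>\<box> A \<^bold>\<longrightarrow> A)" and z: "R y z"
      have "\<forall>u. R z u \<longrightarrow> sat R S v u (\<^bold>\<box> A \<^bold>\<longrightarrow> A)"
        using hyp transpD[OF trans z] by blast
      with less z have "\<forall>u. R z u \<longrightarrow> sat R S v u A" unfolding conversep_iff by blast
      with hyp z show "sat R S v z A" by simp
    qed
  qed
  then show ?case unfolding sat.simps by blast
next
  case (J3 A C B)
  show ?case unfolding sat.simps by blast
next
  case (P A B)
  have "R x z" if "R x y" "R y z" for y z using transpD[OF trans] that .
  then show ?case unfolding sat.simps by blast
next
  case (R1 A B C)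
  then show ?case unfolding sat.simps by blast
next
  case (R2 A B C)
  then show ?case unfolding sat.simps by blast
qed simp_all

section \<open>The model of inseparable pairs\<close>

text \<open>The remaining connectives are definable, so only this fragment needs a truth lemma.\<close>

primrec core :: "fm \<Rightarrow> bool" where
  "core (Var p) = True"
| "core \<^bold>\<bottom> = True"
| "core (\<^bold>\<not> A) = False"
| "core (A \<^bold>\<and> B) = False"
| "core (A \<^bold>\<or> B) = False"
| "core (A \<^bold>\<longrightarrow> B) = (core A \<and> core B)"
| "core (\<^bold>\<box> A) = False"
| "core (A \<rhd> B) = (core A \<and> core B)"

locale closed_pair =
  fixes \<Phi>1 \<Phi>2 :: "fm set" and V :: "nat set"
  assumes finite1: "finite \<Phi>1" and finite2: "finite \<Phi>2"
    and closed1: "\<And>A B. (A \<^bold>\<longrightarrow> B) \<in> \<Phi>1 \<or> A \<rhd> B \<in> \<Phi>1 \<Longrightarrow> A \<in> \<Phi>1 \<and> B \<in> \<Phi>1"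
    and closed2: "\<And>A B. (A \<^bold>\<longrightarrow> B) \<in> \<Phi>2 \<or> A \<rhd> B \<in> \<Phi>2 \<Longrightarrow> A \<in> \<Phi>2 \<and> B \<in> \<Phi>2"
    and var_common: "\<And>F. F \<in> \<Phi>1 \<Longrightarrow> F \<in> \<Phi>2 \<Longrightarrow> var F \<subseteq> V"
begin

fun world :: "fm \<times> fm \<times> fm \<Rightarrow> bool" where
  "world (\<alpha>, \<beta>, D) \<longleftrightarrow> \<not> sep V \<alpha> \<beta> \<and> decides \<alpha> \<Phi>1 \<and> decides \<beta> \<Phi>2"

fun holds :: "fm \<times> fm \<times> fm \<Rightarrow> fm \<Rightarrow> bool" where
  "holds (\<alpha>, \<beta>, D) F \<longleftrightarrow>
     F \<in> \<Phi>1 \<and> (IL\<^sup>-(P) \<turnstile> \<alpha> \<^bold>\<longrightarrow> F) \<or> F \<in> \<Phi>2 \<and> (IL\<^sup>-(P) \<turnstile> \<beta> \<^bold>\<longrightarrow> F)"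

fun tag :: "fm \<times> fm \<times> fm \<Rightarrow> fm" where
  "tag (\<alpha>, \<beta>, D) = D"

text \<open>One relation \<open>S\<close> serves all worlds because a world records in its tag the only formula
  that its \<open>S\<close>-successors have to avoid.\<close>

definition S :: "fm \<times> fm \<times> fm \<Rightarrow> fm \<times> fm \<times> fm \<Rightarrow> bool" where
  "S x y \<longleftrightarrow> world y \<and> \<not> holds y (tag x)"

definition rhds :: "fm \<times> fm \<times> fm \<Rightarrow> (fm \<times> fm) set" where
  "rhds x = {(X, Y). holds x (X \<rhd> Y)}"

text \<open>The second condition builds into \<open>R\<close> the truth of the \<open>\<rhd>\<close>-formulas at \<open>x\<close>. This
  keeps \<open>R\<close> transitive because \<open>\<rhd>\<close>-formulas persist.\<close>

definition R :: "fm \<times> fm \<times> fm \<Rightarrow> fm \<times> fm \<times> fm \<Rightarrow> bool" where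
  "R x y \<longleftrightarrow> world y \<and> rhds x \<subset> rhds y \<and>
     (\<forall>(X, Y)\<in>rhds x. holds y X \<longrightarrow> (\<exists>z. S y z \<and> holds z Y))"

lemma R_trans: "transp R"
  unfolding transp_def R_def by blast

lemma finite_all_rhds: "finite (\<Union>x. rhds x)"
proof (rule finite_subset)
  show "(\<Union>x. rhds x) \<subseteq> (\<lambda>F. case F of X \<rhd> Y \<Rightarrow> (X, Y)) ` (\<Phi>1 \<union> \<Phi>2)"
  proof
    fix p assume "p \<in> (\<Union>x. rhds x)"
    then obtain x X Y where p: "p = (X, Y)" and h: "holds x (X \<rhd> Y)"
      unfolding rhds_def by blast
    from h have "X \<rhd> Y \<in> \<Phi>1 \<union> \<Phi>2" by (cases x) auto
    then show "p \<in> (\<lambda>F. case F of X \<rhd> Y \<Rightarrow> (X, Y)) ` (\<Phi>1 \<union> \<Phi>2)"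
      unfolding p by (rule rev_image_eqI) simp
  qed
qed (simp add: finite1 finite2)

lemma finite_rhds: "finite (rhds x)"
  using finite_all_rhds by (rule rev_finite_subset) blast

text \<open>Each step along \<open>R\<close> uses up at least one of the finitely many \<open>\<rhd>\<close>-formulas still to become true.\<close>

lemma R_wf: "wfP R\<inverse>\<inverse>"
proof -
  let ?U = "\<Union>x. rhds x"
  have U: "rhds x \<subseteq> ?U" for x by blast
  from finite_all_rhds have "card (?U - rhds y) < card (?U - rhds x)" if "R x y" for x y
    using that U[of x] U[of y] unfolding R_def by (intro psubset_card_mono) auto
  then have "{(y, x). R x y} \<subseteq> measure (\<lambda>x. card (?U - rhds x))" by auto
  then have "wf {(y, x). R x y}" by (rule wf_subset[OF wf_measure])
  then show ?thesis by (simp add: wfp_def conversep_iff)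
qed

text \<open>On formulas common to both sides \<open>\<alpha>\<close> and \<open>\<beta>\<close> cannot disagree, since such a formula
  would separate them.\<close>

lemma holds_iff:
  assumes w: "world (\<alpha>, \<beta>, D)"
  shows "F \<in> \<Phi>1 \<Longrightarrow> holds (\<alpha>, \<beta>, D) F \<longleftrightarrow> (IL\<^sup>-(P) \<turnstile> \<alpha> \<^bold>\<longrightarrow> F)"
    and "F \<in> \<Phi>2 \<Longrightarrow> holds (\<alpha>, \<beta>, D) F \<longleftrightarrow> (IL\<^sup>-(P) \<turnstile> \<beta> \<^bold>\<longrightarrow> F)"
proof -
  have agree: "(IL\<^sup>-(P) \<turnstile> \<alpha> \<^bold>\<longrightarrow> F) \<longleftrightarrow> (IL\<^sup>-(P) \<turnstile> \<beta> \<^bold>\<longrightarrow> F)" if F: "F \<in> \<Phi>1" "F \<in> \<Phi>2" for F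
  proof (rule ccontr)
    assume neq: "\<not> ?thesis"
    have dec: "(IL\<^sup>-(P) \<turnstile> \<alpha> \<^bold>\<longrightarrow> F) \<or> (IL\<^sup>-(P) \<turnstile> \<alpha> \<^bold>\<longrightarrow> \<^bold>\<not> F)"
      "(IL\<^sup>-(P) \<turnstile> \<beta> \<^bold>\<longrightarrow> F) \<or> (IL\<^sup>-(P) \<turnstile> \<beta> \<^bold>\<longrightarrow> \<^bold>\<not> F)"
      using w F by (auto simp: decides_def)
    have "sep V \<alpha> \<beta>"
    proof (cases "IL\<^sup>-(P) \<turnstile> \<alpha> \<^bold>\<longrightarrow> F")
      case True
      with neq dec have "IL\<^sup>-(P) \<turnstile> \<beta> \<^bold>\<longrightarrow> \<^bold>\<not> F" by blast
      then have "IL\<^sup>-(P) \<turnstile> F \<^bold>\<longrightarrow> \<^bold>\<not> \<beta>" by (rule taut_infer1) auto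
      with True var_common[OF F] show ?thesis by (intro sepI)
    next
      case False
      with neq dec have 1: "IL\<^sup>-(P) \<turnstile> \<beta> \<^bold>\<longrightarrow> F" and 2: "IL\<^sup>-(P) \<turnstile> \<alpha> \<^bold>\<longrightarrow> \<^bold>\<not> F" by blast+
      from 2 have "IL\<^sup>-(P) \<turnstile> F \<^bold>\<longrightarrow> \<^bold>\<not> \<alpha>" by (rule taut_infer1) auto
      with 1 var_common[OF F] have "sep V \<beta> \<alpha>" by (intro sepI)
      then show ?thesis by (rule sep_sym)
    qed
    with w show False by simp
  qed
  show "F \<in> \<Phi>1 \<Longrightarrow> holds (\<alpha>, \<beta>, D) F \<longleftrightarrow> (IL\<^sup>-(P) \<turnstile> \<alpha> \<^bold>\<longrightarrow> F)"
    and "F \<in> \<Phi>2 \<Longrightarrow> holds (\<alpha>, \<beta>, D) F \<longleftrightarrow> (IL\<^sup>-(P) \<turnstile> \<beta> \<^bold>\<longrightarrow> F)"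
    using agree by auto
qed

lemma world_consistent:
  assumes "\<not> sep V \<alpha> \<beta>"
  shows "IL\<^sup>-(P) \<turnstile> \<alpha> \<^bold>\<longrightarrow> F \<Longrightarrow> \<not> (IL\<^sup>-(P) \<turnstile> \<alpha> \<^bold>\<longrightarrow> \<^bold>\<not> F)"
    and "IL\<^sup>-(P) \<turnstile> \<beta> \<^bold>\<longrightarrow> F \<Longrightarrow> \<not> (IL\<^sup>-(P) \<turnstile> \<beta> \<^bold>\<longrightarrow> \<^bold>\<not> F)"
proof -
  have gen: "sep V \<gamma> \<delta>" if "IL\<^sup>-(P) \<turnstile> \<gamma> \<^bold>\<longrightarrow> F" "IL\<^sup>-(P) \<turnstile> \<gamma> \<^bold>\<longrightarrow> \<^bold>\<not> F" for \<gamma> \<delta> F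
  proof (rule sepI)
    show "var \<^bold>\<bottom> \<subseteq> V" by simp
    from that show "IL\<^sup>-(P) \<turnstile> \<gamma> \<^bold>\<longrightarrow> \<^bold>\<bottom>" by (rule taut_infer2) auto
    show "IL\<^sup>-(P) \<turnstile> \<^bold>\<bottom> \<^bold>\<longrightarrow> \<^bold>\<not> \<delta>" by (rule taut_infer) simp
  qed
  show "IL\<^sup>-(P) \<turnstile> \<alpha> \<^bold>\<longrightarrow> F \<Longrightarrow> \<not> (IL\<^sup>-(P) \<turnstile> \<alpha> \<^bold>\<longrightarrow> \<^bold>\<not> F)"
    "IL\<^sup>-(P) \<turnstile> \<beta> \<^bold>\<longrightarrow> F \<Longrightarrow> \<not> (IL\<^sup>-(P) \<turnstile> \<beta> \<^bold>\<longrightarrow> \<^bold>\<not> F)"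
    using assms gen sep_sym by blast+
qed

lemma world_exists:
  assumes "\<not> sep V \<alpha> \<beta>"
  obtains \<alpha>' \<beta>' where "\<And>D. world (\<alpha>', \<beta>', D)" "IL\<^sup>-(P) \<turnstile> \<alpha>' \<^bold>\<longrightarrow> \<alpha>" "IL\<^sup>-(P) \<turnstile> \<beta>' \<^bold>\<longrightarrow> \<beta>"
  using decides_extension_pair[OF finite1 finite2 assms] by (metis world.simps)

lemma holds_imp:
  assumes w: "world x" and F: "(A \<^bold>\<longrightarrow> B) \<in> \<Phi>1 \<union> \<Phi>2"
  shows "holds x (A \<^bold>\<longrightarrow> B) \<longleftrightarrow> (holds x A \<longrightarrow> holds x B)"
proof -
  obtain \<alpha> \<beta> D where x: "x = (\<alpha>, \<beta>, D)" by (cases x) auto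
  have gen: "(IL\<^sup>-(P) \<turnstile> \<gamma> \<^bold>\<longrightarrow> (A \<^bold>\<longrightarrow> B)) \<longleftrightarrow> ((IL\<^sup>-(P) \<turnstile> \<gamma> \<^bold>\<longrightarrow> A) \<longrightarrow> (IL\<^sup>-(P) \<turnstile> \<gamma> \<^bold>\<longrightarrow> B))"
    if "(IL\<^sup>-(P) \<turnstile> \<gamma> \<^bold>\<longrightarrow> A) \<or> (IL\<^sup>-(P) \<turnstile> \<gamma> \<^bold>\<longrightarrow> \<^bold>\<not> A)" for \<gamma>
  proof
    assume 1: "IL\<^sup>-(P) \<turnstile> \<gamma> \<^bold>\<longrightarrow> (A \<^bold>\<longrightarrow> B)"
    show "(IL\<^sup>-(P) \<turnstile> \<gamma> \<^bold>\<longrightarrow> A) \<longrightarrow> (IL\<^sup>-(P) \<turnstile> \<gamma> \<^bold>\<longrightarrow> B)"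
    proof
      assume "IL\<^sup>-(P) \<turnstile> \<gamma> \<^bold>\<longrightarrow> A"
      with 1 show "IL\<^sup>-(P) \<turnstile> \<gamma> \<^bold>\<longrightarrow> B" by (rule taut_infer2) auto
    qed
  next
    assume "(IL\<^sup>-(P) \<turnstile> \<gamma> \<^bold>\<longrightarrow> A) \<longrightarrow> (IL\<^sup>-(P) \<turnstile> \<gamma> \<^bold>\<longrightarrow> B)"
    with that have "(IL\<^sup>-(P) \<turnstile> \<gamma> \<^bold>\<longrightarrow> B) \<or> (IL\<^sup>-(P) \<turnstile> \<gamma> \<^bold>\<longrightarrow> \<^bold>\<not> A)" by blast
    then show "IL\<^sup>-(P) \<turnstile> \<gamma> \<^bold>\<longrightarrow> (A \<^bold>\<longrightarrow> B)"
      by (elim disjE) (erule taut_infer1, simp)+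
  qed
  from F show ?thesis
  proof
    assume F: "(A \<^bold>\<longrightarrow> B) \<in> \<Phi>1"
    with closed1 have AB: "A \<in> \<Phi>1" "B \<in> \<Phi>1" by blast+
    with w x have "(IL\<^sup>-(P) \<turnstile> \<alpha> \<^bold>\<longrightarrow> A) \<or> (IL\<^sup>-(P) \<turnstile> \<alpha> \<^bold>\<longrightarrow> \<^bold>\<not> A)" by (simp add: decides_def)
    from gen[OF this] show ?thesis using w F AB unfolding x by (simp only: holds_iff)
  next
    assume F: "(A \<^bold>\<longrightarrow> B) \<in> \<Phi>2"
    with closed2 have AB: "A \<in> \<Phi>2" "B \<in> \<Phi>2" by blast+
    with w x have "(IL\<^sup>-(P) \<turnstile> \<beta> \<^bold>\<longrightarrow> A) \<or> (IL\<^sup>-(P) \<turnstile> \<beta> \<^bold>\<longrightarrow> \<^bold>\<not> A)" by (simp add: decides_def)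
    from gen[OF this] show ?thesis using w F AB unfolding x by (simp only: holds_iff)
  qed
qed

lemma holds_bot: "world x \<Longrightarrow> \<not> holds x \<^bold>\<bottom>"
proof
  assume w: "world x" and h: "holds x \<^bold>\<bottom>"
  obtain \<alpha> \<beta> D where x: "x = (\<alpha>, \<beta>, D)" by (cases x) auto
  have "IL\<^sup>-(P) \<turnstile> \<gamma> \<^bold>\<longrightarrow> \<^bold>\<not> \<^bold>\<bottom>" for \<gamma> by (rule taut_infer) simp
  with h w x world_consistent[of \<alpha> \<beta> "\<^bold>\<bottom>"] show False by auto
qed

text \<open>This carries the truth lemma for \<open>\<rhd>\<close>: a triple at which \<open>C \<rhd> D\<close> fails sees a triple
  with \<open>C\<close> whose tag \<open>D\<close> keeps all its \<open>S\<close>-successors away from \<open>D\<close>. The diagonal formula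
  \<open>C \<rhd> D\<close>, true at the new triple, makes the step along \<open>R\<close> strict.\<close>

lemma refuting_successor_left:
  assumes w: "world (\<alpha>, \<beta>, T)" and CD: "C \<rhd> D \<in> \<Phi>1" and no: "\<not> holds (\<alpha>, \<beta>, T) (C \<rhd> D)"
  obtains \<alpha>' \<beta>' where "R (\<alpha>, \<beta>, T) (\<alpha>', \<beta>', D)" "holds (\<alpha>', \<beta>', D) C"
proof -
  let ?x = "(\<alpha>, \<beta>, T)"
  from CD closed1 have C1: "C \<in> \<Phi>1" and D1: "D \<in> \<Phi>1" by blast+
  define \<Gamma>1 where "\<Gamma>1 = {(X, Y) \<in> rhds ?x. X \<rhd> Y \<in> \<Phi>1}"
  define \<Gamma>2 where "\<Gamma>2 = {(X, Y) \<in> rhds ?x. X \<rhd> Y \<in> \<Phi>2}"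
  (* An S-successor of a triple tagged D serves X |> Y only if it satisfies Y and refutes D.
     Where none exists, X has to fail at the successor of x. *)
  define Bad :: "(fm \<times> fm) set" where "Bad = {(X, Y). \<not> (\<exists>z. world z \<and> \<not> holds z D \<and> holds z Y)}"
  have rhds_eq: "rhds ?x = \<Gamma>1 \<union> \<Gamma>2" unfolding \<Gamma>1_def \<Gamma>2_def rhds_def by auto
  have negD: "\<not> holds (\<gamma>, \<delta>, E) D" if "world (\<gamma>, \<delta>, E)" "IL\<^sup>-(P) \<turnstile> \<gamma> \<^bold>\<longrightarrow> \<^bold>\<not> D" for \<gamma> \<delta> E
    using that D1 holds_iff(1)[OF that(1) D1] world_consistent(1) by auto
  have insep: "\<not> sep V \<alpha> \<beta>" using w by simp
  have fin: "finite \<Gamma>1" "finite \<Gamma>2"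
    using finite_rhds[of ?x] unfolding rhds_eq by auto
  have g1: "IL\<^sup>-(P) \<turnstile> \<alpha> \<^bold>\<longrightarrow> (X \<rhd> Y)" if "(X, Y) \<in> \<Gamma>1" for X Y
    using that holds_iff(1)[OF w] unfolding \<Gamma>1_def rhds_def by blast
  have g2: "IL\<^sup>-(P) \<turnstile> \<beta> \<^bold>\<longrightarrow> (X \<rhd> Y)" if "(X, Y) \<in> \<Gamma>2" for X Y
    using that holds_iff(2)[OF w] unfolding \<Gamma>2_def rhds_def by blast
  have neg: "IL\<^sup>-(P) \<turnstile> \<alpha> \<^bold>\<longrightarrow> \<^bold>\<not> (C \<rhd> D)"
    using w no CD holds_iff(1)[OF w CD] by (auto simp: decides_def)
  have i1: "sep V (Y \<^bold>\<and> \<^bold>\<not> D) (\<^bold>\<not> \<^bold>\<bottom>)" if XY: "(X, Y) \<in> \<Gamma>1 \<inter> Bad" for X Y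
  proof (rule ccontr)
    assume "\<not> ?thesis"
    then obtain \<gamma> \<delta> where z: "world (\<gamma>, \<delta>, D)" and \<gamma>: "IL\<^sup>-(P) \<turnstile> \<gamma> \<^bold>\<longrightarrow> Y \<^bold>\<and> \<^bold>\<not> D"
      using world_exists by metis
    from \<gamma> have "IL\<^sup>-(P) \<turnstile> \<gamma> \<^bold>\<longrightarrow> Y" by (rule taut_infer1) auto
    moreover from \<gamma> have "IL\<^sup>-(P) \<turnstile> \<gamma> \<^bold>\<longrightarrow> \<^bold>\<not> D" by (rule taut_infer1) auto
    moreover have "Y \<in> \<Phi>1" using XY closed1 unfolding \<Gamma>1_def by blast
    ultimately show False using z negD[OF z] XY unfolding Bad_def by auto
  qed
  have i2: "sep V (\<^bold>\<not> D) Y" if XY: "(X, Y) \<in> \<Gamma>2 \<inter> Bad" for X Y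
  proof (rule ccontr)
    assume "\<not> ?thesis"
    then obtain \<gamma> \<delta> where z: "world (\<gamma>, \<delta>, D)" and "IL\<^sup>-(P) \<turnstile> \<gamma> \<^bold>\<longrightarrow> \<^bold>\<not> D"
      and "IL\<^sup>-(P) \<turnstile> \<delta> \<^bold>\<longrightarrow> Y"
      using world_exists by metis
    moreover have "Y \<in> \<Phi>2" using XY closed2 unfolding \<Gamma>2_def by blast
    ultimately show False using negD[OF z] XY unfolding Bad_def by auto
  qed
  obtain \<alpha>0 \<beta>0 where s: "\<not> sep V \<alpha>0 \<beta>0"
    "IL\<^sup>-(P) \<turnstile> \<alpha>0 \<^bold>\<longrightarrow> C" "IL\<^sup>-(P) \<turnstile> \<alpha>0 \<^bold>\<longrightarrow> (C \<rhd> D)"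
    "\<And>X Y. (X, Y) \<in> \<Gamma>1 \<Longrightarrow> IL\<^sup>-(P) \<turnstile> \<alpha>0 \<^bold>\<longrightarrow> (X \<rhd> Y)"
    "\<And>X Y. (X, Y) \<in> \<Gamma>2 \<Longrightarrow> IL\<^sup>-(P) \<turnstile> \<beta>0 \<^bold>\<longrightarrow> (X \<rhd> Y)"
    "\<And>X Y. (X, Y) \<in> \<Gamma>1 \<inter> Bad \<Longrightarrow> IL\<^sup>-(P) \<turnstile> \<alpha>0 \<^bold>\<longrightarrow> \<^bold>\<not> X"
    "\<And>X Y. (X, Y) \<in> \<Gamma>2 \<inter> Bad \<Longrightarrow> IL\<^sup>-(P) \<turnstile> \<beta>0 \<^bold>\<longrightarrow> \<^bold>\<not> X"
    by (rule inseparable_successor[OF insep fin g1 g2 neg Int_lower1 Int_lower1 i1 i2]) blast+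
  obtain \<alpha>' \<beta>' where y: "world (\<alpha>', \<beta>', D)"
    and e: "IL\<^sup>-(P) \<turnstile> \<alpha>' \<^bold>\<longrightarrow> \<alpha>0" "IL\<^sup>-(P) \<turnstile> \<beta>' \<^bold>\<longrightarrow> \<beta>0"
    using world_exists[OF s(1)] by metis
  let ?y = "(\<alpha>', \<beta>', D)"
  have mono: "(X, Y) \<in> rhds ?y" if "(X, Y) \<in> rhds ?x" for X Y
    using that s(4,5) imp_trans[OF e(1)] imp_trans[OF e(2)]
    unfolding rhds_eq unfolding \<Gamma>1_def \<Gamma>2_def rhds_def by auto
  have new: "(C, D) \<in> rhds ?y"
    using imp_trans[OF e(1) s(3)] CD unfolding rhds_def by simp
  have old: "(C, D) \<notin> rhds ?x" using no unfolding rhds_def by blast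
  have serve: "\<exists>z. S ?y z \<and> holds z Y" if XY: "(X, Y) \<in> rhds ?x" and X: "holds ?y X" for X Y
  proof (rule ccontr)
    assume "\<not> ?thesis"
    then have bad: "(X, Y) \<in> Bad" unfolding S_def Bad_def by auto
    from XY consider "(X, Y) \<in> \<Gamma>1" | "(X, Y) \<in> \<Gamma>2" unfolding rhds_eq by blast
    then show False
    proof cases
      case 1
      with bad s(6) have "IL\<^sup>-(P) \<turnstile> \<alpha>' \<^bold>\<longrightarrow> \<^bold>\<not> X" using imp_trans[OF e(1)] by blast
      moreover have "X \<in> \<Phi>1" using 1 closed1 unfolding \<Gamma>1_def by blast
      ultimately show False using X holds_iff(1)[OF y] world_consistent(1) y by (metis world.simps)
    next
      case 2
      with bad s(7) have "IL\<^sup>-(P) \<turnstile> \<beta>' \<^bold>\<longrightarrow> \<^bold>\<not> X" using imp_trans[OF e(2)] by blast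
      moreover have "X \<in> \<Phi>2" using 2 closed2 unfolding \<Gamma>2_def by blast
      ultimately show False using X holds_iff(2)[OF y] world_consistent(2) y by (metis world.simps)
    qed
  qed
  have "rhds ?x \<subset> rhds ?y" using mono new old by auto
  then have "R ?x ?y" unfolding R_def using y serve by (auto simp del: holds.simps world.simps)
  moreover have "holds ?y C" using imp_trans[OF e(1) s(2)] C1 by simp
  ultimately show ?thesis using that by blast
qed

text \<open>The construction is symmetric in the two sides, so the previous lemma applies to the
  model with the components exchanged.\<close>

lemma refuting_successor:
  assumes w: "world x" and CD: "C \<rhd> D \<in> \<Phi>1 \<union> \<Phi>2" and no: "\<not> holds x (C \<rhd> D)"
  obtains y where "R x y" "holds y C" "tag y = D"
proof -
  obtain \<alpha> \<beta> T where x: "x = (\<alpha>, \<beta>, T)" by (cases x) auto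
  from CD show ?thesis
  proof
    assume "C \<rhd> D \<in> \<Phi>1"
    then show ?thesis using refuting_successor_left w no that unfolding x by (metis tag.simps)
  next
    assume CD2: "C \<rhd> D \<in> \<Phi>2"
    interpret flip: closed_pair \<Phi>2 \<Phi>1 V
      by unfold_locales (use finite1 finite2 closed1 closed2 var_common in blast)+
    have world_flip: "flip.world (\<delta>, \<gamma>, E) \<longleftrightarrow> world (\<gamma>, \<delta>, E)" for \<gamma> \<delta> E
      using sep_sym by auto
    have holds_flip: "flip.holds (\<delta>, \<gamma>, E) F \<longleftrightarrow> holds (\<gamma>, \<delta>, E) F" for \<gamma> \<delta> E F
      by auto
    have rhds_flip: "flip.rhds (\<delta>, \<gamma>, E) = rhds (\<gamma>, \<delta>, E)" for \<gamma> \<delta> E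
      unfolding rhds_def flip.rhds_def holds_flip ..
    have S_flip: "flip.S (\<delta>, \<gamma>, E) (\<delta>', \<gamma>', E') \<longleftrightarrow> S (\<gamma>, \<delta>, E) (\<gamma>', \<delta>', E')" for \<gamma> \<delta> E \<gamma>' \<delta>' E'
      unfolding S_def flip.S_def world_flip holds_flip flip.tag.simps tag.simps ..
    have R_flip: "flip.R (\<delta>, \<gamma>, E) (\<delta>', \<gamma>', E') \<Longrightarrow> R (\<gamma>, \<delta>, E) (\<gamma>', \<delta>', E')" for \<gamma> \<delta> E \<gamma>' \<delta>' E'
      unfolding R_def flip.R_def world_flip rhds_flip holds_flip split_paired_Ex S_flip by blast
    from w no have "flip.world (\<beta>, \<alpha>, T)" "\<not> flip.holds (\<beta>, \<alpha>, T) (C \<rhd> D)"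
      unfolding x world_flip holds_flip by auto
    then obtain \<alpha>' \<beta>' where "flip.R (\<beta>, \<alpha>, T) (\<beta>', \<alpha>', D)" "flip.holds (\<beta>', \<alpha>', D) C"
      using flip.refuting_successor_left[OF _ CD2] by metis
    then show ?thesis using that[of "(\<alpha>', \<beta>', D)"] R_flip unfolding x holds_flip by simp
  qed
qed

abbreviation model_sat :: "fm \<times> fm \<times> fm \<Rightarrow> fm \<Rightarrow> bool" where
  "model_sat \<equiv> sat R S (\<lambda>x p. holds x (Var p))"

lemma truth:
  "core F \<Longrightarrow> world x \<Longrightarrow> F \<in> \<Phi>1 \<union> \<Phi>2 \<Longrightarrow> model_sat x F \<longleftrightarrow> holds x F"
proof (induction F arbitrary: x)
  case (Imp A B)
  then have "A \<in> \<Phi>1 \<union> \<Phi>2" "B \<in> \<Phi>1 \<union> \<Phi>2" using closed1 closed2 by blast+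
  with Imp show ?case using holds_imp by simp
next
  case (Rhd A B)
  then have AB: "A \<in> \<Phi>1 \<union> \<Phi>2" "B \<in> \<Phi>1 \<union> \<Phi>2" using closed1 closed2 by blast+
  have A: "model_sat y A \<longleftrightarrow> holds y A" and B: "model_sat y B \<longleftrightarrow> holds y B" if "world y" for y
    using Rhd AB that by auto
  show ?case
  proof
    assume sat: "model_sat x (A \<rhd> B)"
    show "holds x (A \<rhd> B)"
    proof (rule ccontr)
      assume "\<not> ?thesis"
      then obtain y where y: "R x y" "holds y A" "tag y = B"
        using refuting_successor Rhd.prems by metis
      then have "model_sat y A" using A unfolding R_def by blast
      with sat y(1) obtain z where "S y z" "model_sat z B"
        unfolding sat.simps by blast
      with y(3) B show False unfolding S_def by blast
    qed
  next
    assume "holds x (A \<rhd> B)"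
    then have "(A, B) \<in> rhds x" unfolding rhds_def by simp
    then have "\<exists>z. S y z \<and> model_sat z B" if "R x y" "model_sat y A" for y
      using that A B unfolding R_def S_def by blast
    then show "model_sat x (A \<rhd> B)" by simp
  qed
qed (use holds_bot in auto)

end

section \<open>Reduction to the fragment and interpolation\<close>

primrec tr :: "fm \<Rightarrow> fm" where
  "tr (Var p) = Var p"
| "tr \<^bold>\<bottom> = \<^bold>\<bottom>"
| "tr (\<^bold>\<not> A) = (tr A \<^bold>\<longrightarrow> \<^bold>\<bottom>)"
| "tr (A \<^bold>\<and> B) = ((tr A \<^bold>\<longrightarrow> (tr B \<^bold>\<longrightarrow> \<^bold>\<bottom>)) \<^bold>\<longrightarrow> \<^bold>\<bottom>)"
| "tr (A \<^bold>\<or> B) = ((tr A \<^bold>\<longrightarrow> \<^bold>\<bottom>) \<^bold>\<longrightarrow> tr B)"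
| "tr (A \<^bold>\<longrightarrow> B) = (tr A \<^bold>\<longrightarrow> tr B)"
| "tr (\<^bold>\<box> A) = (tr A \<^bold>\<longrightarrow> \<^bold>\<bottom>) \<rhd> \<^bold>\<bottom>"
| "tr (A \<rhd> B) = tr A \<rhd> tr B"

lemma core_tr: "core (tr A)"
  by (induction A) auto

lemma var_tr: "var (tr A) = var A"
  by (induction A) auto

lemma rhd_cong:
  assumes "IL\<^sup>-(P) \<turnstile> A \<^bold>\<longleftrightarrow> A'" "IL\<^sup>-(P) \<turnstile> B \<^bold>\<longleftrightarrow> B'"
  shows "IL\<^sup>-(P) \<turnstile> (A \<rhd> B) \<^bold>\<longleftrightarrow> (A' \<rhd> B')"
proof -
  have mono: "IL\<^sup>-(P) \<turnstile> (C \<rhd> D) \<^bold>\<longrightarrow> (C' \<rhd> D')"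
    if C: "IL\<^sup>-(P) \<turnstile> C' \<^bold>\<longrightarrow> C" and D: "IL\<^sup>-(P) \<turnstile> D \<^bold>\<longrightarrow> D'" for C C' D D'
    using ILmP.R1[OF D] ILmP.R2[OF C] by (rule imp_trans)
  have a: "IL\<^sup>-(P) \<turnstile> A \<^bold>\<longrightarrow> A'" "IL\<^sup>-(P) \<turnstile> A' \<^bold>\<longrightarrow> A"
    by (rule taut_infer1[OF assms(1)], simp)+
  have b: "IL\<^sup>-(P) \<turnstile> B \<^bold>\<longrightarrow> B'" "IL\<^sup>-(P) \<turnstile> B' \<^bold>\<longrightarrow> B"
    by (rule taut_infer1[OF assms(2)], simp)+
  show ?thesis using mono[OF a(2) b(1)] mono[OF a(1) b(2)] by (rule taut_infer2) simp
qed

lemma tr_equiv: "IL\<^sup>-(P) \<turnstile> A \<^bold>\<longleftrightarrow> tr A"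
proof (induction A)
  case (Box A)
  then have "IL\<^sup>-(P) \<turnstile> (\<^bold>\<not> A) \<^bold>\<longleftrightarrow> (tr A \<^bold>\<longrightarrow> \<^bold>\<bottom>)" by (rule taut_infer1) auto
  moreover have "IL\<^sup>-(P) \<turnstile> \<^bold>\<bottom> \<^bold>\<longleftrightarrow> \<^bold>\<bottom>" by (rule taut_infer) simp
  ultimately have "IL\<^sup>-(P) \<turnstile> ((\<^bold>\<not> A) \<rhd> \<^bold>\<bottom>) \<^bold>\<longleftrightarrow> ((tr A \<^bold>\<longrightarrow> \<^bold>\<bottom>) \<rhd> \<^bold>\<bottom>)" by (rule rhd_cong)
  with ILmP.J6 show ?case unfolding tr.simps by (rule taut_infer2) auto
next
  case (Rhd A B)
  then show ?case by (simp add: rhd_cong)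
next
  case (Var p)
  show ?case by (rule taut_infer) simp
next
  case Falsum
  show ?case by (rule taut_infer) simp
next
  case (Neg A)
  then show ?case by (rule taut_infer1) auto
next
  case (Conj A B)
  then show ?case by (rule taut_infer2) auto
next
  case (Disj A B)
  then show ?case by (rule taut_infer2) auto
next
  case (Imp A B)
  then show ?case by (rule taut_infer2) auto
qed

primrec subs :: "fm \<Rightarrow> fm set" where
  "subs (Var p) = {Var p}"
| "subs \<^bold>\<bottom> = {\<^bold>\<bottom>}"
| "subs (\<^bold>\<not> A) = insert (\<^bold>\<not> A) (subs A)"
| "subs (A \<^bold>\<and> B) = insert (A \<^bold>\<and> B) (subs A \<union> subs B)"
| "subs (A \<^bold>\<or> B) = insert (A \<^bold>\<or> B) (subs A \<union> subs B)"
| "subs (A \<^bold>\<longrightarrow> B) = insert (A \<^bold>\<longrightarrow> B) (subs A \<union> subs B)"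
| "subs (\<^bold>\<box> A) = insert (\<^bold>\<box> A) (subs A)"
| "subs (A \<rhd> B) = insert (A \<rhd> B) (subs A \<union> subs B)"

lemma finite_subs: "finite (subs A)"
  by (induction A) auto

lemma subs_refl: "A \<in> subs A"
  by (cases A) auto

lemma subs_closed:
  "(B \<^bold>\<longrightarrow> C) \<in> subs A \<or> B \<rhd> C \<in> subs A \<Longrightarrow> B \<in> subs A \<and> C \<in> subs A"
  by (induction A) (auto simp: subs_refl)

lemma var_subs: "F \<in> subs A \<Longrightarrow> var F \<subseteq> var A"
  by (induction A) auto

lemma core_interpolation:
  assumes core: "core A" "core B" and prov: "IL\<^sup>-(P) \<turnstile> A \<^bold>\<longrightarrow> B"
  shows "\<exists>C. var C \<subseteq> var A \<inter> var B \<and> (IL\<^sup>-(P) \<turnstile> A \<^bold>\<longrightarrow> C) \<and> (IL\<^sup>-(P) \<turnstile> C \<^bold>\<longrightarrow> B)"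
proof -
  let ?V = "var A \<inter> var B"
  interpret closed_pair "subs A" "subs B" ?V
  proof (rule closed_pair.intro)
    fix F assume "F \<in> subs A" "F \<in> subs B"
    then show "var F \<subseteq> ?V" by (simp add: var_subs)
  qed (fact finite_subs subs_closed)+
  have "sep ?V A (\<^bold>\<not> B)"
  proof (rule ccontr)
    assume "\<not> ?thesis"
    then obtain \<alpha> \<beta> where w: "world (\<alpha>, \<beta>, \<^bold>\<bottom>)"
      and A: "IL\<^sup>-(P) \<turnstile> \<alpha> \<^bold>\<longrightarrow> A" and B: "IL\<^sup>-(P) \<turnstile> \<beta> \<^bold>\<longrightarrow> \<^bold>\<not> B"
      using world_exists by metis
    have "holds (\<alpha>, \<beta>, \<^bold>\<bottom>) A" using A subs_refl by simp
    moreover have "\<not> holds (\<alpha>, \<beta>, \<^bold>\<bottom>) B"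
      using w B holds_iff(2)[OF w subs_refl] world_consistent(2) by (metis world.simps)
    ultimately have "\<not> model_sat (\<alpha>, \<beta>, \<^bold>\<bottom>) (A \<^bold>\<longrightarrow> B)"
      using truth[OF _ w] core subs_refl by (simp del: holds.simps)
    then show False using soundness[OF prov R_trans R_wf] by blast
  qed
  then obtain C where "var C \<subseteq> ?V" "IL\<^sup>-(P) \<turnstile> A \<^bold>\<longrightarrow> C" and C: "IL\<^sup>-(P) \<turnstile> C \<^bold>\<longrightarrow> \<^bold>\<not> \<^bold>\<not> B"
    unfolding sep_def by blast
  moreover from C have "IL\<^sup>-(P) \<turnstile> C \<^bold>\<longrightarrow> B" by (rule taut_infer1) auto
  ultimately show ?thesis by blast
qed

theorem theorem3p9:
  fixes A B :: fm
  assumes "IL\<^sup>-(P) \<turnstile> A \<^bold>\<longrightarrow> B"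
  shows "\<exists>C. var C \<subseteq> var A \<inter> var B \<and> (IL\<^sup>-(P) \<turnstile> A \<^bold>\<longrightarrow> C) \<and> (IL\<^sup>-(P) \<turnstile> C \<^bold>\<longrightarrow> B)"
proof -
  have "IL\<^sup>-(P) \<turnstile> tr A \<^bold>\<longrightarrow> tr B"
    using assms tr_equiv[of A] tr_equiv[of B] by (rule taut_infer3) auto
  then obtain C where "var C \<subseteq> var A \<inter> var B"
    and C: "IL\<^sup>-(P) \<turnstile> tr A \<^bold>\<longrightarrow> C" "IL\<^sup>-(P) \<turnstile> C \<^bold>\<longrightarrow> tr B"
    using core_interpolation[OF core_tr core_tr] unfolding var_tr by blast
  moreover from tr_equiv[of A] C(1) have "IL\<^sup>-(P) \<turnstile> A \<^bold>\<longrightarrow> C" by (rule taut_infer2) auto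
  moreover from tr_equiv[of B] C(2) have "IL\<^sup>-(P) \<turnstile> C \<^bold>\<longrightarrow> B" by (rule taut_infer2) auto
  ultimately show ?thesis by blast
qed

end
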